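(* Consider the tree dyadic model with repeated coefficients (RCM). It admits a constant componentwise solution $u$ such that, for all $p\ge1$ and $s\in\mathbb R$, $u\in W^{s,p}$ if and only if $s<s_0(p)$, where $$s_0(p)=\frac13\Bigl(\alpha-\frac d2\Bigr)+\frac12\bigl(\ell_{3/2}-\ell_{p/2}\bigr).$$ This $u$ is the unique constant solution inside any $H^s$ (i.e. for every $s\in\mathbb R$, every constant componentwise solution belonging to $H^s$ equals $u$). It has the explicit formula $$u_j=f\cdot2^{q|j|+q}\prod_{k\le j}\sqrt{d_k},\qquad j\in J,\qquad\text{where}\quad q=-\frac13(\alpha+d)-\frac12\ell_{3/2}.$$ If $\alpha>\frac d2$, then $s_0(2)>0$ and hence $u\in H=H^0=l^2(J)$, so $u$ is a Leray solution.
   Context: Tree: let $d\ge1$ be an integer, $N=2^d$. $J=\bigcup_{n\ge0}\{1,\dots,N\}^n$ is the set of finite words, $\emptyset$ the empty word, $|j|$ the length of $j$; $j\le k$ means $j$ is a prefix of $k$; for $j\neq\emptyset$, $\bar\jmath$ is $j$ with its last letter removed; $\mathcal O_j=\{k\in J:\bar k=j\}$. Model: given $\alpha>0$, $f>0$ and positive coefficients $(d_j)_{j\in J}$ with $d_\emptyset=1$, let $c_j=d_j2^{\alpha|j|}$ and consider $$v_j'(t)=c_jv_{\bar\jmath}^2(t)-\sum_{k\in\mathcal O_j}c_kv_j(t)v_k(t),\qquad j\in J,\ t\ge0,$$ with $v_{\bar\emptyset}(t)\equiv f$. A constant componentwise solution is a family $u=(u_j)_{j\in J}$ of non-negative reals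 with $c_ju_{\bar\jmath}^2=\sum_{k\in\mathcal O_j}c_ku_ju_k$ for all $j\in J$ (with $u_{\bar\emptyset}=f$). It is Leray if $u\in l^2(J)$. RCM: there is a family $\{\delta_\omega:\omega\in\Omega\}$ of positive numbers, $|\Omega|=N$, such that for every $j\in J$ the multiset $\{d_k:k\in\mathcal O_j\}$ equals $\{\delta_\omega:\omega\in\Omega\}$ (with multiplicities). For $s\ne0$, $\ell_s=\frac1s\log_2\bigl(\frac1N\sum_\omega\delta_\omega^s\bigr)$. Spaces: for $s\in\mathbb R$, $p\ge1$, $W^{s,p}$ is the set of $u:J\to\mathbb R$ with $$\|u\|_{W^{s,p}}=\Bigl(\sum_{j\in J}2^{ps|j|}2^{d(\frac p2-1)|j|}|u_j|^p\Bigr)^{1/p}<\infty,$$ and $H^s=W^{s,2}$, i.e. $\sum_{j}2^{2s|j|}u_j^2<\infty$. *)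

theory Defs
  imports "HOL-Analysis.Analysis" "HOL-Library.Multiset" "HOL-Library.Sublist"
begin

text \<open>
  Nodes of the tree are words over the alphabet \<open>{1..2^d}\<close>, represented as lists. A family
  indexed by the set of words is represented by a function on all lists of which only the values
  on \<open>words d\<close> are ever used.
\<close>

definition words :: "nat \<Rightarrow> nat list set" where
  "words d = {j. set j \<subseteq> {1..2 ^ d}}"

definition children :: "nat \<Rightarrow> nat list \<Rightarrow> nat list set" where
  "children d j = {k \<in> words d. k \<noteq> [] \<and> butlast k = j}"

definition c_coeff :: "real \<Rightarrow> (nat list \<Rightarrow> real) \<Rightarrow> nat list \<Rightarrow> real" where
  "c_coeff \<alpha> dc j = dc j * 2 powr (\<alpha> * real (length j))"

text \<open>The value at the parent of \<open>j\<close>; the fictitious parent of the root carries the forcing \<open>f\<close>.\<close>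

definition parent_val :: "real \<Rightarrow> (nat list \<Rightarrow> real) \<Rightarrow> nat list \<Rightarrow> real" where
  "parent_val f u j = (if j = [] then f else u (butlast j))"

definition const_solution ::
    "nat \<Rightarrow> real \<Rightarrow> real \<Rightarrow> (nat list \<Rightarrow> real) \<Rightarrow> (nat list \<Rightarrow> real) \<Rightarrow> bool" where
  "const_solution d \<alpha> f dc u \<longleftrightarrow>
     (\<forall>j\<in>words d. u j \<ge> 0) \<and>
     (\<forall>j\<in>words d. c_coeff \<alpha> dc j * (parent_val f u j)\<^sup>2
        = (\<Sum>k\<in>children d j. c_coeff \<alpha> dc k * u j * u k))"

definition l2 :: "nat \<Rightarrow> (nat list \<Rightarrow> real) set" where
  "l2 d = {u. (\<lambda>j. (u j)\<^sup>2) summable_on words d}"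

definition leray_solution ::
    "nat \<Rightarrow> real \<Rightarrow> real \<Rightarrow> (nat list \<Rightarrow> real) \<Rightarrow> (nat list \<Rightarrow> real) \<Rightarrow> bool" where
  "leray_solution d \<alpha> f dc u \<longleftrightarrow> const_solution d \<alpha> f dc u \<and> u \<in> l2 d"

text \<open>
  Repeated coefficients: below every node the coefficients are, with multiplicities, the
  family \<open>\<delta>\<close> indexed by \<open>\<Omega>\<close>.
\<close>

definition RCM ::
    "nat \<Rightarrow> (nat list \<Rightarrow> real) \<Rightarrow> 'w set \<Rightarrow> ('w \<Rightarrow> real) \<Rightarrow> bool" where
  "RCM d dc \<Omega> \<delta> \<longleftrightarrow>
     finite \<Omega> \<and> card \<Omega> = 2 ^ d \<and> (\<forall>\<omega>\<in>\<Omega>. \<delta> \<omega> > 0) \<and>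
     (\<forall>j\<in>words d. image_mset dc (mset_set (children d j)) = image_mset \<delta> (mset_set \<Omega>))"

definition ell :: "nat \<Rightarrow> 'w set \<Rightarrow> ('w \<Rightarrow> real) \<Rightarrow> real \<Rightarrow> real" where
  "ell d \<Omega> \<delta> s = 1 / s * log 2 (1 / 2 ^ d * (\<Sum>\<omega>\<in>\<Omega>. \<delta> \<omega> powr s))"

text \<open>
  The summands are non-negative, so finiteness of the norm is summability of the family.
\<close>

definition W :: "nat \<Rightarrow> real \<Rightarrow> real \<Rightarrow> (nat list \<Rightarrow> real) set" where
  "W d s p = {u. (\<lambda>j. 2 powr (p * s * real (length j))
                     * 2 powr (real d * (p / 2 - 1) * real (length j))
                     * \<bar>u j\<bar> powr p) summable_on words d}"

definition H :: "nat \<Rightarrow> real \<Rightarrow> (nat list \<Rightarrow> real) set" where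
  "H d s = W d s 2"

lemma H_altdef: "H d s = {u. (\<lambda>j. 2 powr (2 * s * real (length j)) * (u j)\<^sup>2) summable_on words d}"
  by (simp add: H_def W_def)

lemma H_0_eq_l2: "H d 0 = l2 d"
  by (simp add: H_altdef l2_def)

definition s0 :: "nat \<Rightarrow> real \<Rightarrow> 'w set \<Rightarrow> ('w \<Rightarrow> real) \<Rightarrow> real \<Rightarrow> real" where
  "s0 d \<alpha> \<Omega> \<delta> p = 1 / 3 * (\<alpha> - real d / 2) + 1 / 2 * (ell d \<Omega> \<delta> (3 / 2) - ell d \<Omega> \<delta> (p / 2))"

definition q_exp :: "nat \<Rightarrow> real \<Rightarrow> 'w set \<Rightarrow> ('w \<Rightarrow> real) \<Rightarrow> real" where
  "q_exp d \<alpha> \<Omega> \<delta> = - (1 / 3) * (\<alpha> + real d) - 1 / 2 * ell d \<Omega> \<delta> (3 / 2)"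

end

theory Submission
  imports Defs
begin

text \<open>
  On words of length \<open>n\<close> the sums of \<open>u\<^sup>p\<close> form a geometric progression in \<open>n\<close>, so membership in
  \<open>W\<close> means that its ratio, including the weight, is less than 1. For uniqueness, compare another
  solution \<open>v\<close> with \<open>u\<close> and let \<open>r j\<close> be the growth factor of \<open>v / u\<close> from the parent of \<open>j\<close> to
  \<open>j\<close>. The equation says that \<open>1 / (r j)\<^sup>2\<close> is a weighted mean of the \<open>r k\<close> over the children \<open>k\<close>.
  If some \<open>r j \<noteq> 1\<close>, choosing children alternately above and below the mean gives a path on which
  \<open>v / u\<close> grows faster than any exponential; since \<open>u\<close> decays at most exponentially, \<open>v\<close> then
  lies in no \<open>H d s\<close>.
\<close>

section \<open>Summation by levels, and an elementary growth estimate\<close>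

lemma summable_on_nonneg_iff_level_sums:
  fixes g :: "'a \<Rightarrow> real" and h :: "'a \<Rightarrow> nat"
  assumes nonneg: "\<And>x. x \<in> A \<Longrightarrow> g x \<ge> 0" and fin: "\<And>n. finite {x \<in> A. h x = n}"
  shows "g summable_on A \<longleftrightarrow> summable (\<lambda>n. \<Sum>x\<in>{x \<in> A. h x = n}. g x)"
proof -
  have part: "(\<Sum>n<N. \<Sum>x\<in>{x \<in> A. h x = n}. g x) = (\<Sum>x\<in>{x \<in> A. h x < N}. g x)"
    and fin_part: "finite {x \<in> A. h x < N}" for N
  proof -
    have eq: "{x \<in> A. h x < N} = (\<Union>n<N. {x \<in> A. h x = n})" by auto
    show "finite {x \<in> A. h x < N}" unfolding eq using fin by auto
    show "(\<Sum>n<N. \<Sum>x\<in>{x \<in> A. h x = n}. g x) = (\<Sum>x\<in>{x \<in> A. h x < N}. g x)"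
      unfolding eq by (rule sum.UNION_disjoint [symmetric]) (use fin in auto)
  qed
  show ?thesis
  proof
    assume "g summable_on A"
    then have "(\<Sum>n<N. \<Sum>x\<in>{x \<in> A. h x = n}. g x) \<le> infsum g A" for N
      unfolding part by (intro finite_sum_le_infsum) (use fin_part nonneg in auto)
    then show "summable (\<lambda>n. \<Sum>x\<in>{x \<in> A. h x = n}. g x)"
      by (intro summableI_nonneg_bounded) (auto intro: sum_nonneg nonneg)
  next
    assume S: "summable (\<lambda>n. \<Sum>x\<in>{x \<in> A. h x = n}. g x)"
    have "sum g F \<le> (\<Sum>n. \<Sum>x\<in>{x \<in> A. h x = n}. g x)" if F: "finite F" "F \<subseteq> A" for F
    proof -
      \<comment> \<open>If \<open>F\<close> is empty, \<open>Max\<close> has no specified value, but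
        the inclusion in the next line is then trivial.\<close>
      define N where "N = Suc (Max (h ` F))"
      have "F \<subseteq> {x \<in> A. h x < N}" using F by (auto simp: N_def less_Suc_eq_le)
      then have "sum g F \<le> (\<Sum>x\<in>{x \<in> A. h x < N}. g x)"
        using nonneg fin_part by (intro sum_mono2) auto
      also have "\<dots> \<le> (\<Sum>n. \<Sum>x\<in>{x \<in> A. h x = n}. g x)"
        unfolding part [symmetric] by (intro sum_le_suminf S) (auto intro: sum_nonneg nonneg)
      finally show ?thesis .
    qed
    then show "g summable_on A"
      by (intro nonneg_bdd_above_summable_on bdd_aboveI) (use nonneg in auto)
  qed
qed

text \<open>The product of the two powers is the \<open>n\<close>-th power of
  \<open>b * R ^ n\<close>, whose base is eventually at least 2. The bound \<open>n \<ge> 1\<close>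
  serves to make the end of a path of length \<open>2 * n\<close> a node with a true parent.\<close>

lemma geometric_times_square_power_unbounded:
  fixes b R K M :: real
  assumes "b > 0" "R > 1" "K > 0"
  shows "\<exists>n\<ge>1. K * b ^ n * R ^ n\<^sup>2 > M"
proof -
  obtain n1 where n1: "R ^ n1 > 2 / b" using real_arch_pow assms(2) by blast
  obtain n2 where n2: "2 ^ n2 > M / K" using real_arch_pow [of 2 "M / K"] by auto
  define n where "n = max 1 (max n1 n2)"
  have "R ^ n1 \<le> R ^ n" using assms by (intro power_increasing) (auto simp: n_def)
  with n1 have "2 / b \<le> R ^ n" by linarith
  then have "2 \<le> b * R ^ n" using assms by (simp add: field_simps)
  then have "2 ^ n \<le> (b * R ^ n) ^ n" by (intro power_mono) auto
  also have "\<dots> = b ^ n * R ^ n\<^sup>2" by (simp add: power_mult_distrib power_mult power2_eq_square)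
  finally have le: "2 ^ n \<le> b ^ n * R ^ n\<^sup>2" .
  have "(2::real) ^ n2 \<le> 2 ^ n" by (intro power_increasing) (auto simp: n_def)
  with n2 le have "M / K < b ^ n * R ^ n\<^sup>2" by linarith
  then have "M < K * b ^ n * R ^ n\<^sup>2" using assms by (simp add: field_simps)
  then show ?thesis by (intro exI [of _ n]) (simp add: n_def)
qed

section \<open>Words, children and levels of the tree\<close>

lemma children_eq_image:
  "j \<in> words d \<Longrightarrow> children d j = (\<lambda>x. j @ [x]) ` {1..2 ^ d}"
proof (intro equalityI subsetI)
  fix k assume "j \<in> words d" "k \<in> children d j"
  then show "k \<in> (\<lambda>x. j @ [x]) ` {1..2 ^ d}"
    by (cases k rule: rev_cases) (auto simp: children_def words_def)
qed (auto simp: children_def words_def)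

lemma finite_children: "j \<in> words d \<Longrightarrow> finite (children d j)"
  by (simp add: children_eq_image)

lemma childrenD:
  assumes "k \<in> children d j"
  shows "k \<in> words d" "k \<noteq> []" "butlast k = j" "length k = Suc (length j)"
  using assms by (auto simp: children_def simp del: length_greater_0_conv) (cases k, auto)

lemma butlast_words: "j \<in> words d \<Longrightarrow> butlast j \<in> words d"
  by (auto simp: words_def dest: in_set_butlastD)

lemma finite_words_level: "finite {j \<in> words d. length j = n}"
  using finite_lists_length_eq [of "{1..2 ^ d :: nat}" n] by (simp add: words_def)

lemma words_level_Suc:
  "{j \<in> words d. length j = Suc n} = (\<Union>j\<in>{j \<in> words d. length j = n}. children d j)"
  by (auto simp: children_def intro: butlast_words)

lemma words_level_0: "{j \<in> words d. length j = 0} = {[]}"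
  by (auto simp: words_def)

lemma sum_words_level_Suc:
  "(\<Sum>k\<in>{j \<in> words d. length j = Suc n}. g k)
    = (\<Sum>j\<in>{j \<in> words d. length j = n}. \<Sum>k\<in>children d j. g k)"
  unfolding words_level_Suc
  by (rule sum.UNION_disjoint) (auto simp: finite_words_level finite_children dest: childrenD(3))

section \<open>Repeated coefficients and the explicit solution\<close>

locale rcm_tree =
  fixes d :: nat and \<alpha> f :: real and dc :: "nat list \<Rightarrow> real"
    and \<Omega> :: "'w set" and \<delta> :: "'w \<Rightarrow> real"
  assumes f_pos: "f > 0"
    and dc_pos: "\<And>j. j \<in> words d \<Longrightarrow> dc j > 0" and dc_Nil: "dc [] = 1"
    and RCM: "RCM d dc \<Omega> \<delta>"
begin

lemma finite_Omega: "finite \<Omega>" and card_Omega: "card \<Omega> = 2 ^ d"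
  and delta_pos: "\<omega> \<in> \<Omega> \<Longrightarrow> \<delta> \<omega> > 0"
  using RCM by (auto simp: RCM_def)

lemma Omega_nonempty: "\<Omega> \<noteq> {}"
  using card_Omega by auto

text \<open>This is how repeated coefficients are exploited: sums over children of a function of the
  coefficients do not depend on the node. Mapping \<open>g\<close> over the two equal multisets and
  summing gives it.\<close>

lemma sum_children_dc:
  assumes "j \<in> words d"
  shows "(\<Sum>k\<in>children d j. g (dc k)) = (\<Sum>\<omega>\<in>\<Omega>. g (\<delta> \<omega>))"
proof -
  have "image_mset g (image_mset dc (mset_set (children d j)))
      = image_mset g (image_mset \<delta> (mset_set \<Omega>))"
    using RCM assms by (simp add: RCM_def)
  then show ?thesis by (simp add: sum_unfold_sum_mset multiset.map_comp o_def)
qed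

lemma dc_child_range:
  assumes "j \<in> words d" "k \<in> children d j"
  shows "dc k \<in> \<delta> ` \<Omega>"
proof -
  have "set_mset (image_mset dc (mset_set (children d j))) = set_mset (image_mset \<delta> (mset_set \<Omega>))"
    using RCM assms(1) by (simp add: RCM_def)
  then show ?thesis using assms finite_Omega finite_children by auto
qed

abbreviation "q \<equiv> q_exp d \<alpha> \<Omega> \<delta>"

text \<open>There is one factor \<open>2 powr q * sqrt (dc k)\<close> for each prefix
  \<open>k\<close>, the root included. The extra \<open>q\<close> in the exponent belongs to the
  root, so that the one-step recursion also holds there, with \<open>f\<close> as the parent
  value.\<close>

definition usol :: "nat list \<Rightarrow> real" where
  "usol j = f * 2 powr (q * real (length j) + q) * (\<Prod>k\<in>{k \<in> words d. prefix k j}. sqrt (dc k))"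

lemma sum_delta_powr_pos: "(\<Sum>\<omega>\<in>\<Omega>. \<delta> \<omega> powr s) > 0"
  using finite_Omega Omega_nonempty delta_pos by (intro sum_pos) (auto simp: order_less_imp_not_eq2)

lemma sum_delta_powr:
  assumes "s \<noteq> 0"
  shows "(\<Sum>\<omega>\<in>\<Omega>. \<delta> \<omega> powr s) = 2 powr (real d + s * ell d \<Omega> \<delta> s)"
proof -
  have "s * ell d \<Omega> \<delta> s = log 2 (1 / 2 ^ d * (\<Sum>\<omega>\<in>\<Omega>. \<delta> \<omega> powr s))"
    using assms by (simp add: ell_def)
  then have "2 powr (s * ell d \<Omega> \<delta> s) = 1 / 2 ^ d * (\<Sum>\<omega>\<in>\<Omega>. \<delta> \<omega> powr s)"
    using sum_delta_powr_pos [of s] by simp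
  then show ?thesis by (simp add: powr_add powr_realpow)
qed

lemma usol_parent:
  assumes "j \<in> words d"
  shows "usol j = parent_val f usol j * 2 powr q * sqrt (dc j)"
proof (cases j rule: rev_cases)
  case Nil
  have "{k. k \<in> words d \<and> k = []} = {[]}" by (auto simp: words_def)
  then show ?thesis by (simp add: Nil usol_def parent_val_def dc_Nil)
next
  case (snoc i x)
  have fin: "finite {k \<in> words d. prefix k i}"
    by (rule finite_subset [of _ "set (prefixes i)"]) auto
  have "{k \<in> words d. prefix k j} = insert j {k \<in> words d. prefix k i}"
    using assms by (auto simp: snoc)
  moreover have "j \<notin> {k \<in> words d. prefix k i}"
    by (auto simp: snoc dest: prefix_length_le)
  ultimately have "(\<Prod>k\<in>{k \<in> words d. prefix k j}. sqrt (dc k))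
      = sqrt (dc j) * (\<Prod>k\<in>{k \<in> words d. prefix k i}. sqrt (dc k))"
    using fin by simp
  moreover have "2 powr (q * real (length j) + q) = 2 powr (q * real (length i) + q) * 2 powr q"
    by (simp add: snoc algebra_simps flip: powr_add)
  ultimately show ?thesis by (simp add: usol_def parent_val_def snoc)
qed

lemma usol_child:
  assumes "k \<in> children d j"
  shows "usol k = usol j * 2 powr q * sqrt (dc k)"
  using usol_parent [of k] childrenD [OF assms] by (simp add: parent_val_def)

lemma usol_pos: "j \<in> words d \<Longrightarrow> usol j > 0"
  unfolding usol_def using f_pos dc_pos by (intro mult_pos_pos prod_pos) auto

lemma usol_parent_val_pos: "j \<in> words d \<Longrightarrow> parent_val f usol j > 0"
  using usol_pos f_pos butlast_words by (auto simp: parent_val_def)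

lemma c_coeff_pos: "j \<in> words d \<Longrightarrow> c_coeff \<alpha> dc j > 0"
  using dc_pos by (simp add: c_coeff_def)

text \<open>The factor \<open>sqrt (dc k)\<close> of \<open>usol k\<close> turns the coefficient
  into \<open>dc k powr (3 / 2)\<close>, hence the appearance of \<open>ell\<close> at 3/2. The
  value of \<open>q\<close> is the one that makes \<alpha> + q + d + (3/2) ell(3/2) equal to
  -2q.\<close>

lemma sum_children_usol:
  assumes "j \<in> words d"
  shows "(\<Sum>k\<in>children d j. c_coeff \<alpha> dc k * usol k) = 2 powr (\<alpha> * real (length j) - 2 * q) * usol j"
proof -
  have "c_coeff \<alpha> dc k * usol k
      = 2 powr (\<alpha> * real (length j) + \<alpha> + q) * usol j * dc k powr (3 / 2)"
    if "k \<in> children d j" for k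
  proof -
    have "dc k > 0" using dc_pos childrenD(1) [OF that] by auto
    then have "dc k powr (3 / 2) = dc k * sqrt (dc k)"
      using powr_add [of "dc k" 1 "1 / 2"] by (simp add: powr_half_sqrt)
    then show ?thesis
      using childrenD [OF that]
      by (simp add: c_coeff_def usol_child [OF that] powr_add algebra_simps)
  qed
  then have "(\<Sum>k\<in>children d j. c_coeff \<alpha> dc k * usol k)
      = 2 powr (\<alpha> * real (length j) + \<alpha> + q) * usol j * (\<Sum>k\<in>children d j. dc k powr (3 / 2))"
    by (simp add: sum_distrib_left)
  also have "\<dots> = 2 powr (\<alpha> * real (length j) + \<alpha> + q)
      * 2 powr (real d + 3 / 2 * ell d \<Omega> \<delta> (3 / 2)) * usol j"
    using sum_children_dc [OF assms, of "\<lambda>x. x powr (3 / 2)"] by (simp add: sum_delta_powr)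
  also have "\<dots> = 2 powr (\<alpha> * real (length j) - 2 * q) * usol j"
  proof -
    have "\<alpha> * real (length j) + \<alpha> + q + (real d + 3 / 2 * ell d \<Omega> \<delta> (3 / 2))
        = \<alpha> * real (length j) - 2 * q"
      by (simp add: q_exp_def field_simps)
    then show ?thesis by (simp only: flip: powr_add)
  qed
  finally show ?thesis .
qed

text \<open>Squaring the one-step recursion expresses \<open>dc j\<close> times the squared parent
  value through the square of \<open>usol j\<close>. The remaining factor is the same as in
  \<open>sum_children_usol\<close>, so the two sides of the equation agree.\<close>

lemma c_coeff_usol_parent:
  assumes "j \<in> words d"
  shows "c_coeff \<alpha> dc j * (parent_val f usol j)\<^sup>2 = 2 powr (\<alpha> * real (length j) - 2 * q) * (usol j)\<^sup>2"
proof -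
  have "(2 powr q)\<^sup>2 = 2 powr (2 * q)" by (simp add: power2_eq_square flip: powr_add)
  then have "(usol j)\<^sup>2 = (parent_val f usol j)\<^sup>2 * 2 powr (2 * q) * dc j"
    using usol_parent [OF assms] dc_pos [OF assms] by (simp add: power_mult_distrib)
  then show ?thesis by (simp add: c_coeff_def powr_diff)
qed

lemma const_solution_usol: "const_solution d \<alpha> f dc usol"
  unfolding const_solution_def
proof (intro conjI ballI)
  fix j assume j: "j \<in> words d"
  show "usol j \<ge> 0" using usol_pos [OF j] by simp
  have "(\<Sum>k\<in>children d j. c_coeff \<alpha> dc k * usol j * usol k)
      = usol j * (\<Sum>k\<in>children d j. c_coeff \<alpha> dc k * usol k)"
    by (simp add: sum_distrib_left mult_ac)
  then show "c_coeff \<alpha> dc j * (parent_val f usol j)\<^sup>2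
      = (\<Sum>k\<in>children d j. c_coeff \<alpha> dc k * usol j * usol k)"
    unfolding sum_children_usol [OF j] c_coeff_usol_parent [OF j] by (simp add: power2_eq_square)
qed

section \<open>Level sums of powers and membership in the Sobolev spaces\<close>

lemma sum_level_usol_powr:
  assumes p: "p \<noteq> 0"
  shows "(\<Sum>j\<in>{j \<in> words d. length j = n}. usol j powr p)
    = usol [] powr p * (2 powr (p * q + real d + p / 2 * ell d \<Omega> \<delta> (p / 2))) ^ n"
proof (induction n)
  case 0
  show ?case unfolding words_level_0 by simp
next
  case (Suc n)
  \<comment> \<open>The ratio between the sum over the children and the value at the node is
    independent of the node, because the sum of \<open>dc k powr (p / 2)\<close> is.\<close>
  have "(\<Sum>k\<in>children d j. usol k powr p)
      = 2 powr (p * q + real d + p / 2 * ell d \<Omega> \<delta> (p / 2)) * usol j powr p"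
    if j: "j \<in> words d" for j
  proof -
    have "usol k powr p = 2 powr (p * q) * usol j powr p * dc k powr (p / 2)"
      if "k \<in> children d j" for k
    proof -
      have "dc k > 0" using dc_pos childrenD(1) [OF that] by auto
      then have "sqrt (dc k) powr p = dc k powr (p / 2)"
        by (simp add: powr_powr flip: powr_half_sqrt)
      then show ?thesis
        using usol_pos [OF j] \<open>dc k > 0\<close>
        by (simp add: usol_child [OF that] powr_mult powr_powr mult_ac)
    qed
    then have "(\<Sum>k\<in>children d j. usol k powr p)
        = 2 powr (p * q) * usol j powr p * (\<Sum>k\<in>children d j. dc k powr (p / 2))"
      by (simp add: sum_distrib_left)
    also have "\<dots> = 2 powr (p * q) * 2 powr (real d + p / 2 * ell d \<Omega> \<delta> (p / 2)) * usol j powr p"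
      using sum_children_dc [OF j, of "\<lambda>x. x powr (p / 2)"] p by (simp add: sum_delta_powr)
    finally show ?thesis by (simp add: add.assoc flip: powr_add)
  qed
  then show ?case
    unfolding sum_words_level_Suc using Suc.IH by (simp flip: sum_distrib_left)
qed

lemma usol_mem_W_iff:
  assumes p: "p \<ge> 1"
  shows "usol \<in> W d s p \<longleftrightarrow> s < s0 d \<alpha> \<Omega> \<delta> p"
proof -
  \<comment> \<open>The exponent gained per level: the two weights of the norm, then the ratio of
    the level sums of \<open>usol\<close>.\<close>
  define e where "e = p * s + real d * (p / 2 - 1) + (p * q + real d + p / 2 * ell d \<Omega> \<delta> (p / 2))"
  have level: "(\<Sum>j\<in>{j \<in> words d. length j = n}. 2 powr (p * s * real (length j))
      * 2 powr (real d * (p / 2 - 1) * real (length j)) * \<bar>usol j\<bar> powr p)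
      = usol [] powr p * (2 powr e) ^ n" for n
  proof -
    have "(\<Sum>j\<in>{j \<in> words d. length j = n}. 2 powr (p * s * real (length j))
        * 2 powr (real d * (p / 2 - 1) * real (length j)) * \<bar>usol j\<bar> powr p)
        = (\<Sum>j\<in>{j \<in> words d. length j = n}.
            2 powr (real n * (p * s + real d * (p / 2 - 1))) * usol j powr p)"
      by (intro sum.cong refl)
        (auto simp: algebra_simps abs_of_pos [OF usol_pos] simp flip: powr_add)
    also have "\<dots> = 2 powr (real n * (p * s + real d * (p / 2 - 1))) * (usol [] powr p
        * (2 powr (p * q + real d + p / 2 * ell d \<Omega> \<delta> (p / 2))) ^ n)"
      using p by (simp add: sum_level_usol_powr flip: sum_distrib_left)
    also have "\<dots> = usol [] powr p * (2 powr e) ^ n"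
      by (simp add: e_def powr_power algebra_simps flip: powr_add)
    finally show ?thesis .
  qed
  have "usol [] > 0" by (intro usol_pos) (simp add: words_def)
  have "usol \<in> W d s p \<longleftrightarrow> summable (\<lambda>n. usol [] powr p * (2 powr e) ^ n)"
    unfolding W_def mem_Collect_eq
    by (subst summable_on_nonneg_iff_level_sums [where h = length])
      (simp_all only: level finite_words_level, simp_all)
  also have "\<dots> \<longleftrightarrow> summable (\<lambda>n. (2 powr e) ^ n)"
    using \<open>usol [] > 0\<close> by (intro summable_cmult_iff [THEN trans]) auto
  also have "\<dots> \<longleftrightarrow> 2 powr e < 1"
    by (simp add: summable_geometric_iff)
  also have "\<dots> \<longleftrightarrow> e < 0"
    using powr_less_cancel_iff [of 2 e 0] by simp
  \<comment> \<open>The term -d of the weight cancels the d that comes from the number of children.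
    Inserting \<open>q\<close> brings in \<open>ell\<close> at 3/2, while \<open>ell\<close> at p/2
    comes from the level sums.\<close>
  also have "e = p * (s - s0 d \<alpha> \<Omega> \<delta> p)"
    using p by (simp add: e_def s0_def q_exp_def field_simps)
  also have "\<dots> < 0 \<longleftrightarrow> s < s0 d \<alpha> \<Omega> \<delta> p"
    using p by (simp add: mult_less_0_iff)
  finally show ?thesis .
qed

section \<open>Lower bounds for the explicit solution and for other constant solutions\<close>

lemma usol_lower_bound:
  obtains B where "B > 0" "\<And>j. j \<in> words d \<Longrightarrow> usol [] * B ^ length j \<le> usol j"
proof -
  \<comment> \<open>Below the root every coefficient is one of the finitely many values of \<delta>,
    so each step to a child multiplies \<open>usol\<close> by at least
    \<open>2 powr q * sqrt D\<close>.\<close>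
  define D where "D = Min (\<delta> ` \<Omega>)"
  have D: "D > 0" "\<And>\<omega>. \<omega> \<in> \<Omega> \<Longrightarrow> D \<le> \<delta> \<omega>"
    using finite_Omega Omega_nonempty delta_pos by (auto simp: D_def)
  show thesis
  proof (rule that)
    show "2 powr q * sqrt D > 0" using D by simp
    fix j assume "j \<in> words d"
    then show "usol [] * (2 powr q * sqrt D) ^ length j \<le> usol j"
    proof (induction j rule: rev_induct)
      case (snoc x i)
      have i: "i \<in> words d" using butlast_words [OF snoc.prems] by simp
      have child: "i @ [x] \<in> children d i" using snoc.prems by (simp add: children_def)
      have "D \<le> dc (i @ [x])" using dc_child_range [OF i child] D by auto
      have "usol [] * (2 powr q * sqrt D) ^ length (i @ [x])
          = (usol [] * (2 powr q * sqrt D) ^ length i) * (2 powr q * sqrt D)"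
        by simp
      also have "\<dots> \<le> usol i * (2 powr q * sqrt (dc (i @ [x])))"
        using snoc.IH [OF i] D(1) \<open>D \<le> dc (i @ [x])\<close> usol_pos [OF i]
        by (intro mult_mono) auto
      finally show ?case by (simp add: usol_child [OF child] mult.assoc)
    qed simp
  qed
qed

text \<open>If \<open>v\<close> vanished at a node, the right side of the equation there would
  vanish, hence so would the parent value. Positivity therefore passes down from the forcing
  \<open>f\<close>, which makes quotients of solutions legitimate.\<close>

lemma const_solution_pos:
  assumes v: "const_solution d \<alpha> f dc v" and "j \<in> words d"
  shows "v j > 0"
  using assms(2)
proof (induction j rule: rev_induct)
  case Nil
  have "v [] \<noteq> 0"
  proof
    assume "v [] = 0"
    then have "c_coeff \<alpha> dc [] * f\<^sup>2 = 0"
      using v Nil by (auto simp: const_solution_def parent_val_def)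
    then show False using c_coeff_pos [OF Nil] f_pos by simp
  qed
  then show ?case using v Nil by (auto simp: const_solution_def less_le)
next
  case (snoc x i)
  have i: "i \<in> words d" using butlast_words [OF snoc.prems] by simp
  have "v (i @ [x]) \<noteq> 0"
  proof
    assume "v (i @ [x]) = 0"
    then have "c_coeff \<alpha> dc (i @ [x]) * (v i)\<^sup>2 = 0"
      using v snoc.prems by (force simp: const_solution_def parent_val_def)
    then show False using c_coeff_pos [OF snoc.prems] snoc.IH [OF i] by simp
  qed
  then show ?case using v snoc.prems by (auto simp: const_solution_def less_le)
qed

section \<open>Growth factors of the quotient of two solutions, and uniqueness\<close>

definition relval :: "(nat list \<Rightarrow> real) \<Rightarrow> nat list \<Rightarrow> real" where
  "relval v j = v j / usol j"

text \<open>The fictitious parent of the root has quotient 1, since both solutions carry the same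
  forcing.\<close>

definition growth :: "(nat list \<Rightarrow> real) \<Rightarrow> nat list \<Rightarrow> real" where
  "growth v j = relval v j / parent_val 1 (relval v) j"

context
  fixes v :: "nat list \<Rightarrow> real"
  assumes v: "const_solution d \<alpha> f dc v"
begin

lemma relval_pos: "j \<in> words d \<Longrightarrow> relval v j > 0"
  using const_solution_pos [OF v] usol_pos by (simp add: relval_def)

lemma parent_relval_pos: "j \<in> words d \<Longrightarrow> parent_val 1 (relval v) j > 0"
  using relval_pos butlast_words by (auto simp: parent_val_def)

lemma growth_pos: "j \<in> words d \<Longrightarrow> growth v j > 0"
  using relval_pos parent_relval_pos by (simp add: growth_def)

lemma relval_eq: "j \<in> words d \<Longrightarrow> relval v j = growth v j * parent_val 1 (relval v) j"
  using parent_relval_pos [of j] by (simp add: growth_def)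

text \<open>Comparing the equation of \<open>v\<close> with that of \<open>usol\<close> at
  \<open>j\<close> cancels the common factors and leaves a weighted mean. The square of
  \<open>growth v j\<close> is kept inside the sum so that the two sides can be compared term by
  term.\<close>

lemma growth_balance:
  assumes j: "j \<in> words d"
  shows "(\<Sum>k\<in>children d j. c_coeff \<alpha> dc k * usol k * ((growth v j)\<^sup>2 * growth v k))
    = (\<Sum>k\<in>children d j. c_coeff \<alpha> dc k * usol k)"
proof -
  let ?X = "parent_val 1 (relval v) j"
  let ?S = "\<Sum>k\<in>children d j. c_coeff \<alpha> dc k * usol k * growth v k"
  have v_eq: "v k = usol k * relval v k" if "k \<in> words d" for k
    using usol_pos [OF that] by (simp add: relval_def)
  have vpar: "parent_val f v j = parent_val f usol j * ?X"
    using v_eq [OF butlast_words [OF j]] by (simp add: parent_val_def)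
  have vk: "v k = usol k * (growth v k * relval v j)" if "k \<in> children d j" for k
    using childrenD [OF that] v_eq [of k] relval_eq [of k] by (simp add: parent_val_def)
  have "c_coeff \<alpha> dc j * (parent_val f v j)\<^sup>2 = (\<Sum>k\<in>children d j. c_coeff \<alpha> dc k * v j * v k)"
    using v j by (simp add: const_solution_def)
  also have "\<dots> = (\<Sum>k\<in>children d j. usol j * (relval v j)\<^sup>2 * (c_coeff \<alpha> dc k * usol k * growth v k))"
    using j by (intro sum.cong refl) (simp add: vk v_eq power2_eq_square)
  also have "\<dots> = usol j * (relval v j)\<^sup>2 * ?S"
    by (rule sum_distrib_left [symmetric])
  also have "\<dots> = usol j * ?X\<^sup>2 * ((growth v j)\<^sup>2 * ?S)"
    using j by (simp add: relval_eq power_mult_distrib mult_ac)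
  finally have "(c_coeff \<alpha> dc j * (parent_val f usol j)\<^sup>2) * ?X\<^sup>2 = usol j * ?X\<^sup>2 * ((growth v j)\<^sup>2 * ?S)"
    by (simp add: vpar power_mult_distrib mult_ac)
  then have "(usol j * ?X\<^sup>2) * (2 powr (\<alpha> * real (length j) - 2 * q) * usol j)
      = (usol j * ?X\<^sup>2) * ((growth v j)\<^sup>2 * ?S)"
    unfolding c_coeff_usol_parent [OF j] by (simp add: power2_eq_square mult_ac)
  moreover have "usol j * ?X\<^sup>2 \<noteq> 0"
    using usol_pos [OF j] parent_relval_pos [OF j] by simp
  ultimately have "2 powr (\<alpha> * real (length j) - 2 * q) * usol j = (growth v j)\<^sup>2 * ?S"
    by (simp only: mult_cancel_left) simp
  then show ?thesis
    unfolding sum_children_usol [OF j] by (simp add: sum_distrib_left mult_ac)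
qed

lemma children_nonempty: "j \<in> words d \<Longrightarrow> children d j \<noteq> {}"
  by (simp add: children_eq_image)

text \<open>The weights are positive, so if all terms lay below the mean, the sum in
  \<open>growth_balance\<close> would be strictly too small.\<close>

lemma exists_child_growth_ge:
  assumes j: "j \<in> words d"
  obtains k where "k \<in> children d j" "(growth v j)\<^sup>2 * growth v k \<ge> 1"
proof (rule ccontr)
  assume "\<not> thesis"
  with that have lt: "(growth v j)\<^sup>2 * growth v k < 1" if "k \<in> children d j" for k
    using that by force
  have w: "c_coeff \<alpha> dc k * usol k > 0" if "k \<in> children d j" for k
    using c_coeff_pos usol_pos childrenD(1) [OF that] by simp
  have "(\<Sum>k\<in>children d j. c_coeff \<alpha> dc k * usol k * ((growth v j)\<^sup>2 * growth v k))
      < (\<Sum>k\<in>children d j. c_coeff \<alpha> dc k * usol k)"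
    using finite_children [OF j] children_nonempty [OF j]
    by (rule sum_strict_mono) (use lt w in \<open>force simp: mult_less_cancel_left2\<close>)
  then show False using growth_balance [OF j] by simp
qed

lemma exists_child_growth_le:
  assumes j: "j \<in> words d"
  obtains k where "k \<in> children d j" "(growth v j)\<^sup>2 * growth v k \<le> 1"
proof (rule ccontr)
  assume "\<not> thesis"
  with that have gt: "(growth v j)\<^sup>2 * growth v k > 1" if "k \<in> children d j" for k
    using that by force
  have w: "c_coeff \<alpha> dc k * usol k > 0" if "k \<in> children d j" for k
    using c_coeff_pos usol_pos childrenD(1) [OF that] by simp
  have "(\<Sum>k\<in>children d j. c_coeff \<alpha> dc k * usol k)
      < (\<Sum>k\<in>children d j. c_coeff \<alpha> dc k * usol k * ((growth v j)\<^sup>2 * growth v k))"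
    using finite_children [OF j] children_nonempty [OF j]
    by (rule sum_strict_mono) (use gt w in \<open>force simp: mult_less_cancel_left1\<close>)
  then show False using growth_balance [OF j] by simp
qed

text \<open>Write r for growth factors. Below \<open>a\<close> choose \<open>b\<close> with r(b) at
  least 1/r(a)^2, then below \<open>b\<close> choose \<open>c\<close> with r(c) at most 1/r(b)^2,
  hence at most r(a)^4. From the parent of \<open>a\<close> to \<open>b\<close>, the parent of
  \<open>c\<close>, the quotient gains r(a) r(b), at least 1/r(a). These gains have exponents 1, 3,
  5, ..., whose sum is a square. The bound is stated at the parent of \<open>a\<close> because the
  step into \<open>a\<close> is a small factor.\<close>

lemma superexponential_path:
  assumes j: "j \<in> words d" and lt: "growth v j < 1"
  shows "\<exists>a\<in>words d. length a = length j + 2 * n \<and> growth v a \<le> growth v j ^ (2 * n + 1)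
    \<and> parent_val 1 (relval v) a \<ge> parent_val 1 (relval v) j * (1 / growth v j) ^ n\<^sup>2"
proof (induction n)
  case 0
  show ?case using j by (intro bexI [of _ j]) auto
next
  case (Suc n)
  let ?r = "growth v j"
  have r: "?r > 0" by (rule growth_pos [OF j])
  obtain a where a: "a \<in> words d" "length a = length j + 2 * n" "growth v a \<le> ?r ^ (2 * n + 1)"
    "parent_val 1 (relval v) a \<ge> parent_val 1 (relval v) j * (1 / ?r) ^ n\<^sup>2"
    using Suc.IH by blast
  obtain b where b: "b \<in> children d a" "(growth v a)\<^sup>2 * growth v b \<ge> 1"
    using exists_child_growth_ge [OF a(1)] .
  note b' = childrenD [OF b(1)]
  obtain c where c: "c \<in> children d b" "(growth v b)\<^sup>2 * growth v c \<le> 1"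
    using exists_child_growth_le [OF b'(1)] .
  note c' = childrenD [OF c(1)]
  have pos: "growth v a > 0" "growth v b > 0" "growth v c > 0"
    using growth_pos a(1) b'(1) c'(1) by auto
  \<comment> \<open>Squaring the choice of \<open>b\<close> allows it to be combined with the choice
    of \<open>c\<close>, which gives r(c) \<le> r(a)^4.\<close>
  have "1 \<le> ((growth v a)\<^sup>2 * growth v b)\<^sup>2" using b(2) by (simp add: one_le_power)
  then have "growth v c \<le> ((growth v a)\<^sup>2 * growth v b)\<^sup>2 * growth v c"
    using pos by (simp add: mult_le_cancel_right1)
  also have "\<dots> = growth v a ^ 4 * ((growth v b)\<^sup>2 * growth v c)"
    by (simp add: power_mult_distrib flip: power_mult)
  also have "\<dots> \<le> growth v a ^ 4" using c(2) pos by (simp add: mult_le_cancel_left2)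
  also have "\<dots> \<le> (?r ^ (2 * n + 1)) ^ 4" using a(3) pos by (intro power_mono) auto
  also have "\<dots> = ?r ^ (8 * n + 4)"
    unfolding power_mult [symmetric] by (rule arg_cong [where f = "power ?r"]) simp
  \<comment> \<open>The stronger exponent is given up for the next odd number, which is all that
    growth of order \<open>n\<close> squared in the exponent requires.\<close>
  also have "\<dots> \<le> ?r ^ (2 * Suc n + 1)" using r lt by (intro power_decreasing) auto
  finally have growth_c: "growth v c \<le> ?r ^ (2 * Suc n + 1)" .
  have "(1 / ?r) ^ (2 * n + 1) = 1 / ?r ^ (2 * n + 1)" by (simp add: power_one_over)
  also have "\<dots> \<le> 1 / growth v a" using a(3) pos by (intro divide_left_mono) (auto simp: r)
  also have "\<dots> \<le> growth v b * growth v a"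
    using b(2) pos by (simp add: field_simps power2_eq_square)
  finally have step: "(1 / ?r) ^ (2 * n + 1) \<le> growth v b * growth v a" .
  have "parent_val 1 (relval v) j * (1 / ?r) ^ (Suc n)\<^sup>2
      = (1 / ?r) ^ (2 * n + 1) * (parent_val 1 (relval v) j * (1 / ?r) ^ n\<^sup>2)"
  proof -
    have "(Suc n)\<^sup>2 = (2 * n + 1) + n\<^sup>2" by (simp add: power2_eq_square)
    then show ?thesis by (simp only: power_add mult_ac)
  qed
  also have "\<dots> \<le> (growth v b * growth v a) * parent_val 1 (relval v) a"
    using step a(4) pos r parent_relval_pos [OF j] by (intro mult_mono) auto
  also have "\<dots> = parent_val 1 (relval v) c"
    using b' c' relval_eq [OF b'(1)] relval_eq [OF a(1)] by (simp add: parent_val_def)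
  finally have "parent_val 1 (relval v) c \<ge> parent_val 1 (relval v) j * (1 / ?r) ^ (Suc n)\<^sup>2" .
  with growth_c show ?case using a(2) b' c' by (intro bexI [of _ c]) auto
qed

text \<open>A growth factor below 1 starts a path on which the quotient outgrows the exponential
  decay of both \<open>usol\<close> and the weight. A single term of the series defining membership
  in \<open>H d s\<close> would then exceed its sum.\<close>

lemma growth_ge_1:
  assumes H: "v \<in> H d s" and j: "j \<in> words d"
  shows "growth v j \<ge> 1"
proof (rule ccontr)
  assume "\<not> growth v j \<ge> 1"
  then have lt: "growth v j < 1" by simp
  let ?r = "growth v j" and ?X = "parent_val 1 (relval v) j"
  have r: "?r > 0" by (rule growth_pos [OF j])
  obtain B where B: "B > 0" "\<And>j. j \<in> words d \<Longrightarrow> usol [] * B ^ length j \<le> usol j"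
    using usol_lower_bound by metis
  \<comment> \<open>\<open>E\<close> joins the weight per level to the decay rate of
    \<open>usol\<close>; it may well be smaller than 1.\<close>
  define E where "E = 2 powr s * B"
  have E: "E > 0" using B by (simp add: E_def)
  have u0: "usol [] > 0" by (intro usol_pos) (simp add: words_def)
  define M where "M = infsum (\<lambda>j. 2 powr (2 * s * real (length j)) * (v j)\<^sup>2) (words d)"
  have bound: "(usol [] * E ^ length i * relval v i)\<^sup>2 \<le> M" if i: "i \<in> words d" for i
  proof -
    have "usol [] * B ^ length i * relval v i \<le> v i"
      using B(2) [OF i] relval_pos [OF i] usol_pos [OF i]
      by (simp add: relval_def field_simps mult_left_mono)
    then have "2 powr (s * real (length i)) * (usol [] * B ^ length i * relval v i)
        \<le> 2 powr (s * real (length i)) * v i"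
      by (intro mult_left_mono) auto
    then have "usol [] * E ^ length i * relval v i \<le> 2 powr (s * real (length i)) * v i"
      by (simp add: E_def power_mult_distrib powr_power mult_ac)
    then have "(usol [] * E ^ length i * relval v i)\<^sup>2 \<le> (2 powr (s * real (length i)) * v i)\<^sup>2"
      using u0 E relval_pos [OF i] by (intro power_mono) auto
    also have "\<dots> = 2 powr (2 * s * real (length i)) * (v i)\<^sup>2"
      by (simp add: power_mult_distrib powr_power mult_ac)
    also have "\<dots> = (\<Sum>i\<in>{i}. 2 powr (2 * s * real (length i)) * (v i)\<^sup>2)" by simp
    also have "\<dots> \<le> M"
      unfolding M_def using H i by (intro finite_sum_le_infsum) (auto simp: H_altdef)
    finally show ?thesis .
  qed
  have X: "?X > 0" by (rule parent_relval_pos [OF j])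
  \<comment> \<open>The bound is applied at the parent of the path's end, which has length
    \<open>length j + 2 * n - 1\<close>. A real exponent is used for the part independent of
    \<open>n\<close>, as \<open>length j - 1\<close> is negative when \<open>j\<close> is the
    root.\<close>
  define K where "K = usol [] * E powr (real (length j) - 1) * ?X"
  have K: "K > 0" using u0 E X by (simp add: K_def)
  \<comment> \<open>Exceeding 1 as well as \<open>M\<close> ensures that the quantity found is at
    most its own square, which \<open>bound\<close> controls.\<close>
  obtain n where n: "n \<ge> 1" "K * (E\<^sup>2) ^ n * (1 / ?r) ^ n\<^sup>2 > max 1 M"
    using geometric_times_square_power_unbounded [of "E\<^sup>2" "1 / ?r" K "max 1 M"] E r lt K by auto
  obtain a where a: "a \<in> words d" "length a = length j + 2 * n"
    "parent_val 1 (relval v) a \<ge> ?X * (1 / ?r) ^ n\<^sup>2"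
    using superexponential_path [OF j lt] by blast
  let ?i = "butlast a"
  have i: "?i \<in> words d" by (rule butlast_words [OF a(1)])
  have "a \<noteq> []" using a(2) n(1) by auto
  then have rel: "relval v ?i \<ge> ?X * (1 / ?r) ^ n\<^sup>2" using a(3) by (simp add: parent_val_def)
  have "E ^ length ?i = E powr (real (length j) - 1 + 2 * real n)"
    using E a(2) n(1) by (simp add: of_nat_diff algebra_simps flip: powr_realpow)
  also have "\<dots> = E powr (real (length j) - 1) * (E\<^sup>2) ^ n"
    using E by (simp add: powr_add powr_realpow flip: power_mult)
      (metis of_nat_mult of_nat_numeral powr_realpow)
  finally have len: "E ^ length ?i = E powr (real (length j) - 1) * (E\<^sup>2) ^ n" .
  have "max 1 M < K * (E\<^sup>2) ^ n * (1 / ?r) ^ n\<^sup>2" by (rule n(2))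
  also have "\<dots> = usol [] * E ^ length ?i * (?X * (1 / ?r) ^ n\<^sup>2)"
    by (simp only: K_def len mult_ac)
  also have "\<dots> \<le> usol [] * E ^ length ?i * relval v ?i"
    using rel u0 E by (intro mult_left_mono) auto
  finally have big: "max 1 M < usol [] * E ^ length ?i * relval v ?i" (is "_ < ?T") .
  then have "?T \<le> ?T\<^sup>2" by (intro self_le_power) auto
  with big bound [OF i] show False by linarith
qed

text \<open>A factor above 1 is excluded too: some child would then have a factor below 1.\<close>

lemma growth_eq_1:
  assumes H: "v \<in> H d s" and j: "j \<in> words d"
  shows "growth v j = 1"
proof -
  obtain k where k: "k \<in> children d j" "(growth v j)\<^sup>2 * growth v k \<le> 1"
    using exists_child_growth_le [OF j] .
  have ge: "growth v j \<ge> 1" "growth v k \<ge> 1"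
    using growth_ge_1 [OF H] j childrenD(1) [OF k(1)] by auto
  have "growth v j \<le> (growth v j)\<^sup>2" using ge by (simp add: self_le_power)
  also have "\<dots> \<le> (growth v j)\<^sup>2 * growth v k" using ge by (simp add: mult_le_cancel_left1)
  finally show ?thesis using ge k(2) by linarith
qed

lemma const_solution_unique:
  assumes H: "v \<in> H d s" and j: "j \<in> words d"
  shows "v j = usol j"
proof -
  have "relval v j = 1" using j
  proof (induction j rule: rev_induct)
    case Nil
    then show ?case using growth_eq_1 [OF H Nil] by (simp add: growth_def parent_val_def)
  next
    case (snoc x i)
    have "i \<in> words d" using butlast_words [OF snoc.prems] by simp
    then show ?case
      using growth_eq_1 [OF H snoc.prems] snoc.IH by (simp add: growth_def parent_val_def)
  qed
  then show ?thesis using usol_pos [OF j] by (simp add: relval_def)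
qed

end

section \<open>Positivity of the critical exponent at p = 2\<close>

lemma ell_1_le_ell_3_2: "ell d \<Omega> \<delta> 1 \<le> ell d \<Omega> \<delta> (3 / 2)"
proof -
  define m where "m s = 1 / 2 ^ d * (\<Sum>\<omega>\<in>\<Omega>. \<delta> \<omega> powr s)" for s
  have m_pos: "m s > 0" for s using sum_delta_powr_pos by (simp add: m_def)
  \<comment> \<open>Jensen's inequality for the convex power 3/2, with the uniform weights on
    \<Omega>.\<close>
  have "(\<Sum>\<omega>\<in>\<Omega>. (1 / 2 ^ d) *\<^sub>R \<delta> \<omega>) powr (3 / 2) \<le> (\<Sum>\<omega>\<in>\<Omega>. 1 / 2 ^ d * \<delta> \<omega> powr (3 / 2))"
    by (rule convex_on_sum [where C = "{0<..}"])
      (use finite_Omega Omega_nonempty card_Omega delta_pos in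
        \<open>auto intro!: powr_convex simp: order_less_imp_le\<close>)
  moreover have "(\<Sum>\<omega>\<in>\<Omega>. (1 / 2 ^ d) *\<^sub>R \<delta> \<omega>) = m 1"
    by (auto simp: m_def sum_distrib_left abs_of_pos [OF delta_pos] intro!: sum.cong)
  ultimately have "m 1 powr (3 / 2) \<le> m (3 / 2)"
    by (simp add: m_def sum_distrib_left)
  then have "log 2 (m 1 powr (3 / 2)) \<le> log 2 (m (3 / 2))"
    using m_pos [of 1] by (intro log_mono) auto
  then show ?thesis
    using m_pos [of 1] unfolding ell_def m_def [symmetric] by (simp add: log_powr field_simps)
qed

lemma s0_2_pos:
  assumes "\<alpha> > real d / 2"
  shows "s0 d \<alpha> \<Omega> \<delta> 2 > 0"
  unfolding s0_def using assms ell_1_le_ell_3_2 by (intro add_pos_nonneg) simp_all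

end

theorem theorem3p3:
  fixes d :: nat and \<alpha> f :: real and dc :: "nat list \<Rightarrow> real"
    and \<Omega> :: "'w set" and \<delta> :: "'w \<Rightarrow> real"
  assumes "d \<ge> 1" and "\<alpha> > 0" and "f > 0"
    and "\<forall>j\<in>words d. dc j > 0" and "dc [] = 1"
    and "RCM d dc \<Omega> \<delta>"
  shows "\<exists>u. const_solution d \<alpha> f dc u
    \<and> (\<forall>p\<ge>1. \<forall>s. u \<in> W d s p \<longleftrightarrow> s < s0 d \<alpha> \<Omega> \<delta> p)
    \<and> (\<forall>s v. const_solution d \<alpha> f dc v \<and> v \<in> H d s \<longrightarrow> (\<forall>j\<in>words d. v j = u j))
    \<and> (\<forall>j\<in>words d. u j = f * 2 powr (q_exp d \<alpha> \<Omega> \<delta> * real (length j) + q_exp d \<alpha> \<Omega> \<delta>)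
                              * (\<Prod>k\<in>{k \<in> words d. prefix k j}. sqrt (dc k)))
    \<and> (\<alpha> > real d / 2 \<longrightarrow>
          s0 d \<alpha> \<Omega> \<delta> 2 > 0 \<and> u \<in> H d 0 \<and> leray_solution d \<alpha> f dc u)"
proof -
  interpret rcm_tree d \<alpha> f dc \<Omega> \<delta>
    using assms by unfold_locales auto
  show ?thesis
  proof (intro exI [of _ usol] conjI allI impI ballI)
    show sol: "const_solution d \<alpha> f dc usol" by (rule const_solution_usol)
    show "usol \<in> W d s p \<longleftrightarrow> s < s0 d \<alpha> \<Omega> \<delta> p" if "p \<ge> 1" for p s
      by (rule usol_mem_W_iff [OF that])
    show "v j = usol j" if "const_solution d \<alpha> f dc v \<and> v \<in> H d s" "j \<in> words d" for s v j
      using const_solution_unique that by blast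
    show "usol j = f * 2 powr (q * real (length j) + q)
        * (\<Prod>k\<in>{k \<in> words d. prefix k j}. sqrt (dc k))" for j
      by (rule usol_def)
    assume "\<alpha> > real d / 2"
    then show pos: "s0 d \<alpha> \<Omega> \<delta> 2 > 0" by (rule s0_2_pos)
    then show H: "usol \<in> H d 0" by (simp add: H_def usol_mem_W_iff)
    with sol show "leray_solution d \<alpha> f dc usol" by (simp add: leray_solution_def H_0_eq_l2)
  qed
qed

end
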